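(* Let $G\leq\operatorname{Aut}(T)$ be a branch group and let $F\leq G$ be any subgroup. Let $\mathcal C_F$ be the set of all non-open orbit-closures of the action $F\curvearrowright\partial T$. Then the function $\mathcal C_F\to\operatorname{Sub}(G)$, $C\mapsto\operatorname{SStab}_G(C)$, is injective and has values in generalized parabolic subgroups of $G$ (which are all weakly maximal).
   Context: $T$ is a rooted tree; all rooted trees are infinite and spherically regular (the number of children of a vertex depends only on its level), and every vertex has at least two children. $\operatorname{Aut}(T)$ is the group of graph automorphisms fixing the root; $\mathcal L_n$ is the set of vertices of level $n$; $T_v$ is the subtree of descendants of $v$. The boundary $\partial T$ is the set of infinite rays starting at the root, with the metric in which two distinct rays first differing at index $i$ are at distance $2^{-i}$. For $G\le\operatorname{Aut}(T)$, $\operatorname{Rist}_G(v)$ is the subgroup of elements acting trivially outside $T_v$, and $\operatorname{Rist}_G(\mathcal L_n)=\prod_{v\in\mathcal L_n}\operatorname{Rist}_G(v)$. $G$ is branch if it acts transitively on every $\mathcal L_n$ and $\operatorname{Rist}_G(\mathcal L_n)$ has finite index in $G$ for every $n$. $\operatorname{Sub}(G)$ is the set of subgroups of $G$. An orbit-closure of $F\curvearrowright\partial T$ is the closure in $\partial T$ of an $F$-orbit. $\operatorname{SStab}_G(C)$ is the setwise stabilizer of $C\subseteq \partial T$. A generalized parabolic subgroup of $G$ is a subgroup of the form $\operatorname{SStab}_G(C)$ where $C\subset\partial T$ is closed and not open and the action $\operatorname{SStab}_G(C)\curvearrowright C$ is minimal (every orbit is dense in $C$). A subgroup is weakly maximal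 if it is maximal among the subgroups of infinite index of $G$. *)

theory Defs
  imports
    "HOL-Algebra.Group_Action"
    "HOL-Algebra.Generated_Groups"
    "HOL-Analysis.Abstract_Metric_Spaces"
    "HOL-Library.Equipollence"
begin

section \<open>Rooted trees\<close>

record 'v rooted_graph =
  verts :: "'v set"
  edges :: "('v \<times> 'v) set"
  root_vertex :: 'v

definition tree_path :: "('v, 'x) rooted_graph_scheme \<Rightarrow> 'v \<Rightarrow> 'v list \<Rightarrow> 'v \<Rightarrow> bool" where
  "tree_path T u p v \<longleftrightarrow>
     p \<noteq> [] \<and> hd p = u \<and> last p = v \<and> set p \<subseteq> verts T \<and> distinct p \<and>
     successively (\<lambda>x y. (x, y) \<in> edges T) p"

definition rooted_tree :: "('v, 'x) rooted_graph_scheme \<Rightarrow> bool" where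
  "rooted_tree T \<longleftrightarrow>
     edges T \<subseteq> verts T \<times> verts T \<and> sym (edges T) \<and> irrefl (edges T) \<and>
     root_vertex T \<in> verts T \<and>
     (\<forall>u\<in>verts T. \<forall>v\<in>verts T. \<exists>!p. tree_path T u p v)"

definition root_path :: "('v, 'x) rooted_graph_scheme \<Rightarrow> 'v \<Rightarrow> 'v list" where
  "root_path T v = (THE p. tree_path T (root_vertex T) p v)"

definition level_of :: "('v, 'x) rooted_graph_scheme \<Rightarrow> 'v \<Rightarrow> nat" where
  "level_of T v = length (root_path T v) - 1"

definition level :: "('v, 'x) rooted_graph_scheme \<Rightarrow> nat \<Rightarrow> 'v set" where
  "level T n = {v \<in> verts T. level_of T v = n}"

definition children :: "('v, 'x) rooted_graph_scheme \<Rightarrow> 'v \<Rightarrow> 'v set" where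
  "children T v = {w. (v, w) \<in> edges T \<and> level_of T w = Suc (level_of T v)}"

text \<open>The vertex set of the subtree \<open>T\<^sub>v\<close>; the vertex \<open>v\<close> itself belongs to it.\<close>

definition subtree :: "('v, 'x) rooted_graph_scheme \<Rightarrow> 'v \<Rightarrow> 'v set" where
  "subtree T v = {w \<in> verts T. v \<in> set (root_path T w)}"

text \<open>Numbers of children are compared as cardinals (\<open>\<approx>\<close> is equipollence), so no local
  finiteness is imposed on the tree.\<close>

definition spherically_regular_tree :: "('v, 'x) rooted_graph_scheme \<Rightarrow> bool" where
  "spherically_regular_tree T \<longleftrightarrow>
     rooted_tree T \<and> infinite (verts T) \<and>
     (\<forall>u\<in>verts T. \<forall>v\<in>verts T. level_of T u = level_of T v \<longrightarrow> children T u \<approx> children T v) \<and>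
     (\<forall>v\<in>verts T. \<exists>a\<in>children T v. \<exists>b\<in>children T v. a \<noteq> b)"


section \<open>The boundary\<close>

definition tree_boundary :: "('v, 'x) rooted_graph_scheme \<Rightarrow> (nat \<Rightarrow> 'v) set" where
  "tree_boundary T =
     {\<xi>. \<xi> 0 = root_vertex T \<and> (\<forall>n. (\<xi> n, \<xi> (Suc n)) \<in> edges T) \<and> inj \<xi>}"

definition ray_dist :: "(nat \<Rightarrow> 'v) \<Rightarrow> (nat \<Rightarrow> 'v) \<Rightarrow> real" where
  "ray_dist \<xi> \<eta> = (if \<xi> = \<eta> then 0 else (1/2) ^ (LEAST i. \<xi> i \<noteq> \<eta> i))"

lemma ray_dist_nonneg: "0 \<le> ray_dist x y"
  by (simp add: ray_dist_def)

lemma ray_dist_ge: "x k \<noteq> y k \<Longrightarrow> (1/2) ^ k \<le> ray_dist x y"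
  unfolding ray_dist_def by (auto intro!: power_decreasing Least_le)

lemma Metric_space_ray_dist: "Metric_space M ray_dist"
proof
  fix x y z :: "nat \<Rightarrow> 'a"
  show "0 \<le> ray_dist x y" by (rule ray_dist_nonneg)
  show "ray_dist x y = ray_dist y x" by (simp add: ray_dist_def eq_commute)
  show "ray_dist x y = 0 \<longleftrightarrow> x = y" by (simp add: ray_dist_def)
  show "ray_dist x z \<le> ray_dist x y + ray_dist y z"
  proof (cases "x = z")
    case True
    then have "ray_dist x z = 0" by (simp add: ray_dist_def)
    then show ?thesis using ray_dist_nonneg[of x y] ray_dist_nonneg[of y z] by linarith
  next
    case False
    define k where "k = (LEAST i. x i \<noteq> z i)"
    have d: "ray_dist x z = (1/2) ^ k" using False unfolding ray_dist_def k_def by (rule if_not_P)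
    from False obtain i where "x i \<noteq> z i" by blast
    then have "x k \<noteq> z k" unfolding k_def by (rule LeastI)
    then have "x k \<noteq> y k \<or> y k \<noteq> z k" by auto
    then have "(1/2) ^ k \<le> ray_dist x y \<or> (1/2) ^ k \<le> ray_dist y z"
      using ray_dist_ge[of x k y] ray_dist_ge[of y k z] by blast
    then show ?thesis
      unfolding d using ray_dist_nonneg[of x y] ray_dist_nonneg[of y z] by linarith
  qed
qed

definition boundary_topology :: "('v, 'x) rooted_graph_scheme \<Rightarrow> (nat \<Rightarrow> 'v) topology" where
  "boundary_topology T = Metric_space.mtopology (tree_boundary T) ray_dist"


section \<open>Automorphisms and groups acting on the tree\<close>

definition tree_auts :: "('v, 'x) rooted_graph_scheme \<Rightarrow> ('v \<Rightarrow> 'v) set" where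
  "tree_auts T =
     {g \<in> Bij (verts T). g (root_vertex T) = root_vertex T \<and>
        (\<forall>u\<in>verts T. \<forall>v\<in>verts T. (u, v) \<in> edges T \<longleftrightarrow> (g u, g v) \<in> edges T)}"

definition Aut_tree :: "('v, 'x) rooted_graph_scheme \<Rightarrow> ('v \<Rightarrow> 'v) monoid" where
  "Aut_tree T = (BijGroup (verts T))\<lparr>carrier := tree_auts T\<rparr>"

text \<open>A subgroup of \<open>Aut T\<close> given by its set of elements, viewed as a group.\<close>

definition subgrp :: "('v, 'x) rooted_graph_scheme \<Rightarrow> ('v \<Rightarrow> 'v) set \<Rightarrow> ('v \<Rightarrow> 'v) monoid" where
  "subgrp T G = (Aut_tree T)\<lparr>carrier := G\<rparr>"

definition Sub :: "('v, 'x) rooted_graph_scheme \<Rightarrow> ('v \<Rightarrow> 'v) set \<Rightarrow> ('v \<Rightarrow> 'v) set set" where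
  "Sub T G = {H. subgroup H (subgrp T G)}"

definition finite_index ::
    "('v, 'x) rooted_graph_scheme \<Rightarrow> ('v \<Rightarrow> 'v) set \<Rightarrow> ('v \<Rightarrow> 'v) set \<Rightarrow> bool" where
  "finite_index T G H \<longleftrightarrow> finite (rcosets\<^bsub>subgrp T G\<^esub> H)"

definition Rist :: "('v, 'x) rooted_graph_scheme \<Rightarrow> ('v \<Rightarrow> 'v) set \<Rightarrow> 'v \<Rightarrow> ('v \<Rightarrow> 'v) set" where
  "Rist T G v = {g \<in> G. \<forall>w \<in> verts T - subtree T v. g w = w}"

text \<open>The subgroups \<open>Rist T G v\<close>, for \<open>v\<close> on a common level, commute and are independent; their
  (internal direct) product is the subgroup they generate. If the level is infinite, this is the
  restricted product; but such a level cannot occur in the definition of \<open>branch\<close> below, since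
  elements of \<open>Rist_level T G n\<close> fix every vertex of level \<open>n\<close>, so that transitivity and
  finite index force the level to be finite.\<close>

definition Rist_level ::
    "('v, 'x) rooted_graph_scheme \<Rightarrow> ('v \<Rightarrow> 'v) set \<Rightarrow> nat \<Rightarrow> ('v \<Rightarrow> 'v) set" where
  "Rist_level T G n = generate (subgrp T G) (\<Union>v\<in>level T n. Rist T G v)"

definition branch :: "('v, 'x) rooted_graph_scheme \<Rightarrow> ('v \<Rightarrow> 'v) set \<Rightarrow> bool" where
  "branch T G \<longleftrightarrow>
     subgroup G (Aut_tree T) \<and>
     (\<forall>n. \<forall>u\<in>level T n. \<forall>v\<in>level T n. \<exists>g\<in>G. g u = v) \<and>
     (\<forall>n. finite_index T G (Rist_level T G n))"

definition weakly_maximal ::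
    "('v, 'x) rooted_graph_scheme \<Rightarrow> ('v \<Rightarrow> 'v) set \<Rightarrow> ('v \<Rightarrow> 'v) set \<Rightarrow> bool" where
  "weakly_maximal T G H \<longleftrightarrow>
     H \<in> Sub T G \<and> \<not> finite_index T G H \<and>
     (\<forall>K\<in>Sub T G. \<not> finite_index T G K \<and> H \<subseteq> K \<longrightarrow> K = H)"


section \<open>The action on the boundary\<close>

definition boundary_act ::
    "('v, 'x) rooted_graph_scheme \<Rightarrow> ('v \<Rightarrow> 'v) \<Rightarrow> (nat \<Rightarrow> 'v) \<Rightarrow> (nat \<Rightarrow> 'v)" where
  "boundary_act T g = (\<lambda>\<xi>\<in>tree_boundary T. g \<circ> \<xi>)"

definition boundary_orbit ::
    "('v, 'x) rooted_graph_scheme \<Rightarrow> ('v \<Rightarrow> 'v) set \<Rightarrow> (nat \<Rightarrow> 'v) \<Rightarrow> (nat \<Rightarrow> 'v) set" where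
  "boundary_orbit T F \<xi> = orbit (subgrp T F) (boundary_act T) \<xi>"

definition nonopen_orbit_closures ::
    "('v, 'x) rooted_graph_scheme \<Rightarrow> ('v \<Rightarrow> 'v) set \<Rightarrow> (nat \<Rightarrow> 'v) set set" where
  "nonopen_orbit_closures T F =
     {C. (\<exists>\<xi>\<in>tree_boundary T. C = boundary_topology T closure_of boundary_orbit T F \<xi>) \<and>
         \<not> openin (boundary_topology T) C}"

definition SStab ::
    "('v, 'x) rooted_graph_scheme \<Rightarrow> ('v \<Rightarrow> 'v) set \<Rightarrow> (nat \<Rightarrow> 'v) set \<Rightarrow> ('v \<Rightarrow> 'v) set" where
  "SStab T G C = {g \<in> G. boundary_act T g ` C = C}"

definition acts_minimally ::
    "('v, 'x) rooted_graph_scheme \<Rightarrow> ('v \<Rightarrow> 'v) set \<Rightarrow> (nat \<Rightarrow> 'v) set \<Rightarrow> bool" where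
  "acts_minimally T H C \<longleftrightarrow>
     (\<forall>\<xi>\<in>C. C \<subseteq> boundary_topology T closure_of boundary_orbit T H \<xi>)"

definition generalized_parabolics ::
    "('v, 'x) rooted_graph_scheme \<Rightarrow> ('v \<Rightarrow> 'v) set \<Rightarrow> ('v \<Rightarrow> 'v) set set" where
  "generalized_parabolics T G =
     {SStab T G C | C. closedin (boundary_topology T) C \<and> \<not> openin (boundary_topology T) C \<and>
        acts_minimally T (SStab T G C) C}"

end

theory Submission
  imports Defs
begin

text \<open>Let \<open>C\<close> be closed and let \<open>K\<close> be a subgroup containing \<open>SStab(C)\<close>, where \<open>SStab(C)\<close> acts
  minimally on \<open>C\<close>. A rigid stabilizer of a vertex of level \<open>n\<close> not on any ray of \<open>C\<close> stabilizes
  \<open>C\<close>, and minimality makes the vertices of level \<open>n\<close> on rays of \<open>C\<close> conjugate. Hence \<open>K\<close> has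
  finite index as soon as it contains the rigid stabilizer of one vertex on a ray of \<open>C\<close>. If some
  \<open>g \<in> K\<close> moves a point of \<open>C\<close> outside \<open>C\<close>, then \<open>g\<close> conjugates such a rigid stabilizer into
  \<open>SStab(C)\<close>: this gives weak maximality. If \<open>SStab(C) = SStab(D)\<close> and a point of \<open>C\<close> lies
  outside the closed set \<open>D\<close>, then the rigid stabilizer of a vertex on it stabilizes \<open>D\<close>, hence
  \<open>C\<close>, so \<open>SStab(C)\<close> has finite index; an elementary Baire argument excludes this when \<open>C\<close> is not
  open.\<close>

locale tree_group =
  fixes T :: "'v rooted_graph" and G :: "('v \<Rightarrow> 'v) set"
  assumes tree: "rooted_tree T"
    and subgroup_Aut: "subgroup G (Aut_tree T)"
begin

abbreviation \<Gamma> where "\<Gamma> \<equiv> subgrp T G"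
abbreviation B where "B \<equiv> tree_boundary T"
abbreviation act where "act \<equiv> boundary_act T"


section \<open>Rays and the boundary topology\<close>

lemma ray_vertex: "\<xi> \<in> B \<Longrightarrow> \<xi> n \<in> verts T"
  using tree unfolding tree_boundary_def rooted_tree_def by blast

lemma root_path_eq:
  assumes "tree_path T (root_vertex T) p v" shows "root_path T v = p"
proof -
  have "v \<in> verts T"
    using assms unfolding tree_path_def by auto
  then have "\<exists>!p. tree_path T (root_vertex T) p v"
    using tree unfolding rooted_tree_def by blast
  then show ?thesis
    unfolding root_path_def using assms by (rule the1_equality)
qed

lemma tree_path_root_path:
  assumes "v \<in> verts T" shows "tree_path T (root_vertex T) (root_path T v) v"
proof -
  have "\<exists>!p. tree_path T (root_vertex T) p v"
    using tree assms unfolding rooted_tree_def by blast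
  then show ?thesis
    using root_path_eq by blast
qed

text \<open>An initial segment of an injective ray is a path without repetitions, so uniqueness of
  tree paths makes it the root path. Levels and subtrees of ray vertices are computed from
  this.\<close>

lemma root_path_ray:
  assumes "\<xi> \<in> B" shows "root_path T (\<xi> n) = map \<xi> [0..<Suc n]"
proof (rule root_path_eq)
  have "inj \<xi>" "\<xi> 0 = root_vertex T" "\<And>k. (\<xi> k, \<xi> (Suc k)) \<in> edges T"
    using assms unfolding tree_boundary_def by auto
  then show "tree_path T (root_vertex T) (map \<xi> [0..<Suc n]) (\<xi> n)"
    unfolding tree_path_def
    by (auto simp: ray_vertex[OF assms] successively_conv_nth distinct_map hd_map
        simp del: upt_Suc intro: inj_on_subset)
       (auto simp: last_map)
qed

lemma ray_level: "\<xi> \<in> B \<Longrightarrow> \<xi> n \<in> level T n"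
  by (simp add: level_def level_of_def root_path_ray ray_vertex)

text \<open>A vertex determines its root path, so comparing one index settles all smaller
  ones.\<close>

lemma rays_agree_below:
  assumes "\<xi> \<in> B" "\<eta> \<in> B" "\<xi> n = \<eta> n" "k \<le> n"
  shows "\<xi> k = \<eta> k"
proof -
  have "map \<xi> [0..<Suc n] = map \<eta> [0..<Suc n]"
    using assms root_path_ray by metis
  then show ?thesis
    using assms(4) by (simp add: map_eq_conv del: upt_Suc)
qed

text \<open>Agreement at \<open>n\<close> pushes the first difference beyond \<open>n\<close>. Balls
  of radius \<open>(1/2) ^ n\<close> are thus cylinders, and the metric can be replaced by comparing
  vertices level by level.\<close>

lemma ray_dist_less_iff:
  assumes "\<xi> \<in> B" "\<eta> \<in> B" 
  shows "ray_dist \<xi> \<eta> < (1/2) ^ n \<longleftrightarrow> \<xi> n = \<eta> n"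
proof
  assume "ray_dist \<xi> \<eta> < (1/2) ^ n"
  then show "\<xi> n = \<eta> n"
    using ray_dist_ge[of \<xi> n \<eta>] by force
next
  assume eq: "\<xi> n = \<eta> n"
  show "ray_dist \<xi> \<eta> < (1/2) ^ n"
  proof (cases "\<xi> = \<eta>")
    case False
    then obtain i where "\<xi> i \<noteq> \<eta> i" by blast
    then have "\<xi> (LEAST i. \<xi> i \<noteq> \<eta> i) \<noteq> \<eta> (LEAST i. \<xi> i \<noteq> \<eta> i)"
      by (rule LeastI)
    then have "n < (LEAST i. \<xi> i \<noteq> \<eta> i)"
      using rays_agree_below[OF assms eq] not_less by blast
    then show ?thesis
      using False by (simp add: ray_dist_def power_strict_decreasing)
  qed (simp add: ray_dist_def)
qed

lemma ex_power_half_less: "0 < (r::real) \<Longrightarrow> \<exists>n. (1/2) ^ n < r"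
  by (rule real_arch_pow_inv) auto

lemma closure_iff:
  assumes "S \<subseteq> B"
  shows "\<xi> \<in> boundary_topology T closure_of S \<longleftrightarrow> \<xi> \<in> B \<and> (\<forall>n. \<exists>\<eta>\<in>S. \<eta> n = \<xi> n)"
proof -
  interpret Metric_space B ray_dist by (rule Metric_space_ray_dist)
  have "(\<forall>r>0. \<exists>\<eta>\<in>S. ray_dist \<xi> \<eta> < r) \<longleftrightarrow> (\<forall>n. \<exists>\<eta>\<in>S. \<eta> n = \<xi> n)" if "\<xi> \<in> B"
  proof -
    have "(\<forall>r>0. \<exists>\<eta>\<in>S. ray_dist \<xi> \<eta> < r) \<longleftrightarrow> (\<forall>n. \<exists>\<eta>\<in>S. ray_dist \<xi> \<eta> < (1/2) ^ n)"
      (is "?L \<longleftrightarrow> ?R")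
    proof
      assume ?R
      show ?L
      proof (intro allI impI)
        fix r :: real assume "r > 0"
        then obtain n where "(1/2) ^ n < r" using ex_power_half_less by blast
        then show "\<exists>\<eta>\<in>S. ray_dist \<xi> \<eta> < r"
          using \<open>?R\<close> by (meson less_trans)
      qed
    qed simp
    then show ?thesis
      using ray_dist_less_iff[OF that] assms by (simp add: subset_iff Bex_def) metis
  qed
  moreover have "\<xi> \<in> boundary_topology T closure_of S \<longleftrightarrow>
      \<xi> \<in> B \<and> (\<forall>r>0. \<exists>\<eta>\<in>S. ray_dist \<xi> \<eta> < r)"
    using assms unfolding boundary_topology_def metric_closure_of by (auto simp: subset_iff)
  ultimately show ?thesis by blast
qed

lemma closedin_subset_boundary: "closedin (boundary_topology T) C \<Longrightarrow> C \<subseteq> B"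
  using closedin_subset[of "boundary_topology T" C]
  by (simp add: boundary_topology_def Metric_space.topspace_mtopology[OF Metric_space_ray_dist])

lemma closed_avoids:
  assumes "closedin (boundary_topology T) C" "\<xi> \<in> B" "\<xi> \<notin> C"
  shows "\<exists>n. \<forall>\<eta>\<in>C. \<eta> n \<noteq> \<xi> n"
proof -
  have "C \<subseteq> B"
    using assms(1) by (rule closedin_subset_boundary)
  then show ?thesis
    using closure_iff[of C \<xi>] assms closure_of_closedin by blast
qed

text \<open>The witness is a point of \<open>C\<close> that is not interior to it. Minimality later
  spreads this property over all of \<open>C\<close>.\<close>

lemma not_open_witness:
  assumes "\<not> openin (boundary_topology T) C" "C \<subseteq> B"
  obtains \<xi> where "\<xi> \<in> C" "\<forall>n. \<exists>\<eta>\<in>B - C. \<eta> n = \<xi> n"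
proof -
  interpret Metric_space B ray_dist by (rule Metric_space_ray_dist)
  obtain \<xi> where \<xi>: "\<xi> \<in> C" "\<And>r. r > 0 \<Longrightarrow> \<not> mball \<xi> r \<subseteq> C"
    using assms unfolding boundary_topology_def openin_mtopology by blast
  have "\<exists>\<eta>\<in>B - C. \<eta> n = \<xi> n" for n
  proof -
    have "\<not> mball \<xi> ((1/2) ^ n) \<subseteq> C" by (rule \<xi>) simp
    then obtain \<eta> where \<eta>: "\<eta> \<in> B - C" "ray_dist \<xi> \<eta> < (1/2) ^ n"
      by (auto simp: subset_iff)
    then show ?thesis
      using ray_dist_less_iff[of \<xi> \<eta> n] \<xi>(1) assms(2) by (metis DiffD1 subsetD)
  qed
  with \<xi> show ?thesis using that by blast
qed

section \<open>The action on vertices and rays\<close>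

text \<open>\<open>Aut_tree\<close> only replaces the carrier of the group of bijections, so its
  group laws have to come from this subgroup property.\<close>

lemma subgroup_tree_auts: "subgroup (tree_auts T) (BijGroup (verts T))"
proof (rule group.subgroupI[OF group_BijGroup])
  show "tree_auts T \<subseteq> carrier (BijGroup (verts T))"
    by (auto simp: tree_auts_def BijGroup_def)
  have "(\<lambda>x\<in>verts T. x) \<in> tree_auts T"
    using tree by (auto simp: tree_auts_def id_Bij rooted_tree_def)
  then show "tree_auts T \<noteq> {}" by blast
next
  fix g assume g: "g \<in> tree_auts T"
  then have gB: "g \<in> Bij (verts T)" and b: "bij_betw g (verts T) (verts T)"
    by (auto simp: tree_auts_def Bij_def)
  let ?h = "\<lambda>x\<in>verts T. inv_into (verts T) g x"
  have r: "root_vertex T \<in> verts T" using tree by (simp add: rooted_tree_def)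
  have gh: "g (?h x) = x" "?h x \<in> verts T" if "x \<in> verts T" for x
    using that b by (auto simp: bij_betw_inv_into_right Bij_inv_into_mem[OF gB])
  have "?h (root_vertex T) = root_vertex T"
    using g r bij_betw_inv_into_left[OF b r] by (simp add: tree_auts_def)
  \<comment> \<open>The edge condition is an equivalence, which lets it be read backwards along
    \<open>g\<close>.\<close>
  moreover have "(u, v) \<in> edges T \<longleftrightarrow> (?h u, ?h v) \<in> edges T" 
    if "u \<in> verts T" "v \<in> verts T" for u v
    using g gh[OF that(1)] gh[OF that(2)] unfolding tree_auts_def by force
  ultimately have "?h \<in> tree_auts T"
    using restrict_inv_into_Bij[OF gB] by (auto simp: tree_auts_def)
  then show "inv\<^bsub>BijGroup (verts T)\<^esub> g \<in> tree_auts T"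
    by (simp add: inv_BijGroup[OF gB])
next
  fix g h assume g: "g \<in> tree_auts T" and h: "h \<in> tree_auts T"
  have "h v \<in> verts T" if "v \<in> verts T" for v
    using h that by (auto simp: tree_auts_def dest: Bij_imp_funcset)
  then have "compose (verts T) g h \<in> tree_auts T"
    using g h tree unfolding tree_auts_def rooted_tree_def by (simp add: compose_Bij compose_eq)
  then show "g \<otimes>\<^bsub>BijGroup (verts T)\<^esub> h \<in> tree_auts T"
    using g h by (simp add: BijGroup_def tree_auts_def)
qed

sublocale group \<Gamma>
proof -
  have "group (Aut_tree T)"
    unfolding Aut_tree_def
    by (rule group.subgroup_imp_group[OF group_BijGroup subgroup_tree_auts])
  then show "group \<Gamma>"
    unfolding subgrp_def by (rule group.subgroup_imp_group[OF _ subgroup_Aut])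
qed

lemma carrier_eq [simp]: "carrier \<Gamma> = G"
  by (simp add: subgrp_def)

lemma G_auts: "g \<in> G \<Longrightarrow> g \<in> tree_auts T"
  using subgroup.subset[OF subgroup_Aut] by (auto simp: Aut_tree_def)

lemma G_Bij: "g \<in> G \<Longrightarrow> g \<in> Bij (verts T)"
  using G_auts by (auto simp: tree_auts_def)

lemma G_verts: "g \<in> G \<Longrightarrow> v \<in> verts T \<Longrightarrow> g v \<in> verts T"
  using G_Bij Bij_imp_funcset by blast

lemma G_inj_on: "g \<in> G \<Longrightarrow> inj_on g (verts T)"
  using G_Bij by (auto simp: Bij_def bij_betw_def)

lemma mult_apply: "g \<in> G \<Longrightarrow> h \<in> G \<Longrightarrow> v \<in> verts T \<Longrightarrow> (g \<otimes>\<^bsub>\<Gamma>\<^esub> h) v = g (h v)"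
  using G_Bij[of g] G_Bij[of h] by (simp add: subgrp_def Aut_tree_def BijGroup_def compose_eq)

lemma one_apply: "v \<in> verts T \<Longrightarrow> \<one>\<^bsub>\<Gamma>\<^esub> v = v"
  by (simp add: subgrp_def Aut_tree_def BijGroup_def)

lemma inv_G: "g \<in> G \<Longrightarrow> inv\<^bsub>\<Gamma>\<^esub> g \<in> G"
  using inv_closed by simp

lemma mult_G: "g \<in> G \<Longrightarrow> h \<in> G \<Longrightarrow> g \<otimes>\<^bsub>\<Gamma>\<^esub> h \<in> G"
  using m_closed by simp

lemma inv_apply:
  assumes "g \<in> G" "v \<in> verts T"
  shows "(inv\<^bsub>\<Gamma>\<^esub> g) (g v) = v" "g ((inv\<^bsub>\<Gamma>\<^esub> g) v) = v"
  using mult_apply[of "inv\<^bsub>\<Gamma>\<^esub> g" g v] mult_apply[of g "inv\<^bsub>\<Gamma>\<^esub> g" v] inv_G[of g]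
    l_inv[of g] r_inv[of g] one_apply[of v] assms by auto

lemma edge_iff:
  "g \<in> G \<Longrightarrow> u \<in> verts T \<Longrightarrow> v \<in> verts T \<Longrightarrow> (g u, g v) \<in> edges T \<longleftrightarrow> (u, v) \<in> edges T"
  using G_auts unfolding tree_auts_def by blast

lemma root_fixed: "g \<in> G \<Longrightarrow> g (root_vertex T) = root_vertex T"
  using G_auts unfolding tree_auts_def by blast

text \<open>An automorphism fixing the root carries the simple path to \<open>v\<close> to a simple
  path to \<open>g v\<close>; uniqueness does the rest.\<close>

lemma root_path_image:
  assumes g: "g \<in> G" and v: "v \<in> verts T"
  shows "root_path T (g v) = map g (root_path T v)"
proof (rule root_path_eq)
  let ?p = "root_path T v"
  have p: "?p \<noteq> []" "hd ?p = root_vertex T" "last ?p = v" "set ?p \<subseteq> verts T" "distinct ?p"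
    "successively (\<lambda>x y. (x, y) \<in> edges T) ?p"
    using tree_path_root_path[OF v] unfolding tree_path_def by auto
  have "successively (\<lambda>x y. (g x, g y) \<in> edges T) ?p"
    using p(6) by (rule successively_mono) (use p(4) edge_iff[OF g] in auto)
  moreover have "inj_on g (set ?p)"
    using G_inj_on[OF g] p(4) by (rule inj_on_subset)
  ultimately show "tree_path T (root_vertex T) (map g ?p) (g v)"
    using p root_fixed[OF g] G_verts[OF g]
    by (auto simp: tree_path_def hd_map last_map distinct_map successively_map)
qed

lemma subtree_image:
  assumes "g \<in> G" "u \<in> verts T" "w \<in> verts T"
  shows "g w \<in> subtree T (g u) \<longleftrightarrow> w \<in> subtree T u"
proof -
  have "set (root_path T w) \<subseteq> verts T"
    using tree_path_root_path[OF assms(3)] by (simp add: tree_path_def)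
  then show ?thesis
    using assms G_verts G_inj_on[OF assms(1)]
    by (auto simp: subtree_def root_path_image dest: inj_onD)
qed

lemma act_apply: "\<xi> \<in> B \<Longrightarrow> act g \<xi> n = g (\<xi> n)"
  by (simp add: boundary_act_def)

lemma act_ray:
  assumes "g \<in> G" "\<xi> \<in> B" shows "act g \<xi> \<in> B"
proof -
  have "inj (g \<circ> \<xi>)"
    using assms G_inj_on[OF assms(1)] ray_vertex[OF assms(2)]
    by (intro comp_inj_on) (auto simp: tree_boundary_def intro: inj_on_subset)
  then show ?thesis
    using assms root_fixed edge_iff ray_vertex
    by (auto simp: boundary_act_def tree_boundary_def)
qed

lemma act_mult: "g \<in> G \<Longrightarrow> h \<in> G \<Longrightarrow> \<xi> \<in> B \<Longrightarrow> act (g \<otimes>\<^bsub>\<Gamma>\<^esub> h) \<xi> = act g (act h \<xi>)"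
  by (rule ext) (simp add: act_apply act_ray mult_apply ray_vertex)

lemma act_inv:
  assumes "g \<in> G" "\<xi> \<in> B"
  shows "act (inv\<^bsub>\<Gamma>\<^esub> g) (act g \<xi>) = \<xi>" "act g (act (inv\<^bsub>\<Gamma>\<^esub> g) \<xi>) = \<xi>"
  using assms by (auto simp: act_apply act_ray inv_G inv_apply ray_vertex)


section \<open>Setwise stabilizers\<close>

lemma Sub_iff: "H \<in> Sub T G \<longleftrightarrow> subgroup H \<Gamma>"
  by (simp add: Sub_def)

lemma subgroup_subset_G: "subgroup H \<Gamma> \<Longrightarrow> H \<subseteq> G"
  using subgroup.subset by fastforce

lemma SStab_act: "h \<in> SStab T G C \<Longrightarrow> \<xi> \<in> C \<Longrightarrow> act h \<xi> \<in> C"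
  by (auto simp: SStab_def)

lemma subgroup_SStab:
  assumes C: "C \<subseteq> B" shows "subgroup (SStab T G C) \<Gamma>"
proof (rule subgroupI)
  show "SStab T G C \<subseteq> carrier \<Gamma>"
    by (auto simp: SStab_def)
  have "act \<one>\<^bsub>\<Gamma>\<^esub> \<xi> = \<xi>" if "\<xi> \<in> C" for \<xi>
    using that C by (intro ext) (auto simp: act_apply one_apply ray_vertex subset_iff)
  then have "act \<one>\<^bsub>\<Gamma>\<^esub> ` C = C" by force
  then have "\<one>\<^bsub>\<Gamma>\<^esub> \<in> SStab T G C"
    using one_closed by (simp add: SStab_def)
  then show "SStab T G C \<noteq> {}" by blast
next
  fix g assume "g \<in> SStab T G C"
  then have g: "g \<in> G" "act g ` C = C"
    by (auto simp: SStab_def)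
  have "act (inv\<^bsub>\<Gamma>\<^esub> g) ` act g ` C = C"
    using C g(1) by (force simp: image_image act_inv subset_iff)
  then show "inv\<^bsub>\<Gamma>\<^esub> g \<in> SStab T G C"
    using g by (simp add: SStab_def inv_G)
next
  fix g h assume "g \<in> SStab T G C" "h \<in> SStab T G C"
  then have gh: "g \<in> G" "act g ` C = C" "h \<in> G" "act h ` C = C"
    by (auto simp: SStab_def)
  have "act (g \<otimes>\<^bsub>\<Gamma>\<^esub> h) ` C = act g ` act h ` C"
    unfolding image_image using C gh by (intro image_cong) (auto simp: act_mult)
  then show "g \<otimes>\<^bsub>\<Gamma>\<^esub> h \<in> SStab T G C"
    using gh by (simp add: SStab_def mult_G)
qed

text \<open>For a subgroup, one inclusion already gives equality: each point of \<open>C\<close> is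
  the image under \<open>h\<close> of its translate by the inverse of \<open>h\<close>, which again
  lies in \<open>C\<close>.\<close>

lemma subset_SStabI:
  assumes C: "C \<subseteq> B" and H: "subgroup H \<Gamma>" and inv: "\<And>h \<xi>. h \<in> H \<Longrightarrow> \<xi> \<in> C \<Longrightarrow> act h \<xi> \<in> C"
  shows "H \<subseteq> SStab T G C"
proof
  fix h assume h: "h \<in> H"
  then have hG: "h \<in> G" using subgroup_subset_G[OF H] by blast
  have "\<xi> \<in> act h ` C" if \<xi>: "\<xi> \<in> C" for \<xi>
  proof (rule image_eqI)
    show "\<xi> = act h (act (inv\<^bsub>\<Gamma>\<^esub> h) \<xi>)"
      using \<xi> C hG by (auto simp: act_inv)
    show "act (inv\<^bsub>\<Gamma>\<^esub> h) \<xi> \<in> C"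
      using subgroup.m_inv_closed[OF H h] inv \<xi> by blast
  qed
  then show "h \<in> SStab T G C"
    using inv[OF h] hG by (auto simp: SStab_def)
qed

text \<open>Minimality in terms of cylinders: density of an orbit only asks that each point of
  \<open>C\<close> be matched at every level, by an element that may depend on the level. The
  topology thus drops out, see \<open>acts_minimally_iff\<close>.\<close>

definition prefix_transitive :: "('v \<Rightarrow> 'v) set \<Rightarrow> (nat \<Rightarrow> 'v) set \<Rightarrow> bool" where
  "prefix_transitive H C \<longleftrightarrow> (\<forall>\<xi>\<in>C. \<forall>\<eta>\<in>C. \<forall>n. \<exists>h\<in>H. h (\<xi> n) = \<eta> n)"

lemma orbit_eq: "boundary_orbit T H \<xi> = (\<lambda>h. act h \<xi>) ` H"
  by (auto simp: boundary_orbit_def orbit_def subgrp_def)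

lemma orbit_subset: "H \<subseteq> G \<Longrightarrow> \<xi> \<in> B \<Longrightarrow> boundary_orbit T H \<xi> \<subseteq> B"
  by (auto simp: orbit_eq act_ray)

lemma orbit_closure_iff:
  assumes "H \<subseteq> G" "\<xi> \<in> B"
  shows "\<eta> \<in> boundary_topology T closure_of boundary_orbit T H \<xi> \<longleftrightarrow>
    \<eta> \<in> B \<and> (\<forall>n. \<exists>h\<in>H. h (\<xi> n) = \<eta> n)"
  unfolding closure_iff[OF orbit_subset[OF assms]] using assms(2)
  by (simp add: orbit_eq act_apply)

lemma acts_minimally_iff:
  assumes "H \<subseteq> G" "C \<subseteq> B"
  shows "acts_minimally T H C \<longleftrightarrow> prefix_transitive H C"
  using assms orbit_closure_iff[OF assms(1)]
  unfolding acts_minimally_def prefix_transitive_def by (simp add: subset_iff) blast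

text \<open>At level \<open>n\<close> both rays are matched exactly by translates of
  \<open>\<xi>\<close>, so going back to \<open>\<xi>\<close> along \<open>f\<close> and out along
  \<open>g\<close> connects them. This is why orbit closures are minimal.\<close>

lemma prefix_transitive_orbit_closure:
  assumes F: "subgroup F \<Gamma>" and \<xi>: "\<xi> \<in> B"
  shows "prefix_transitive F (boundary_topology T closure_of boundary_orbit T F \<xi>)"
  unfolding prefix_transitive_def
proof (intro ballI allI)
  fix \<eta> \<zeta> n
  assume "\<eta> \<in> boundary_topology T closure_of boundary_orbit T F \<xi>"
    "\<zeta> \<in> boundary_topology T closure_of boundary_orbit T F \<xi>"
  then obtain f g where f: "f \<in> F" "f (\<xi> n) = \<eta> n" and g: "g \<in> F" "g (\<xi> n) = \<zeta> n"
    using orbit_closure_iff[OF subgroup_subset_G[OF F] \<xi>] by metis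
  have FG: "f \<in> G" "g \<in> G" using subgroup_subset_G[OF F] f g by auto
  have v: "\<xi> n \<in> verts T" using \<xi> by (rule ray_vertex)
  have "(g \<otimes>\<^bsub>\<Gamma>\<^esub> inv\<^bsub>\<Gamma>\<^esub> f) (\<eta> n) = \<zeta> n"
    using FG v f(2)[symmetric] g(2) by (simp add: mult_apply inv_G G_verts inv_apply)
  moreover have "g \<otimes>\<^bsub>\<Gamma>\<^esub> inv\<^bsub>\<Gamma>\<^esub> f \<in> F"
    using F f g by (simp add: subgroup.m_closed subgroup.m_inv_closed)
  ultimately show "\<exists>h\<in>F. h (\<eta> n) = \<zeta> n" by blast
qed

text \<open>If \<open>h\<close> carries \<open>\<xi>\<close> to \<open>\<eta>\<close> at level
  \<open>n\<close>, then \<open>f\<close> after \<open>h\<close> carries it to the translate of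
  \<open>\<eta>\<close> by \<open>f\<close>.\<close>

lemma orbit_closure_invariant:
  assumes F: "subgroup F \<Gamma>" and \<xi>: "\<xi> \<in> B"
  shows "F \<subseteq> SStab T G (boundary_topology T closure_of boundary_orbit T F \<xi>)" (is "_ \<subseteq> SStab T G ?C")
proof (rule subset_SStabI[OF _ F])
  note iff = orbit_closure_iff[OF subgroup_subset_G[OF F] \<xi>]
  show "?C \<subseteq> B" using iff by blast
  fix f \<eta> assume f: "f \<in> F" and \<eta>: "\<eta> \<in> ?C"
  have fG: "f \<in> G" using subgroup_subset_G[OF F] f by auto
  have "\<exists>h\<in>F. h (\<xi> n) = act f \<eta> n" for n
  proof -
    obtain h where h: "h \<in> F" "h (\<xi> n) = \<eta> n" using \<eta> iff by blast
    then have "(f \<otimes>\<^bsub>\<Gamma>\<^esub> h) (\<xi> n) = act f \<eta> n"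
      using \<eta> fG \<xi> subgroup_subset_G[OF F] iff by (simp add: mult_apply act_apply ray_vertex subset_iff)
    then show ?thesis
      using subgroup.m_closed[OF F f h(1)] by blast
  qed
  then show "act f \<eta> \<in> ?C"
    using iff act_ray[OF fG] \<eta> by blast
qed


section \<open>Rigid stabilizers\<close>

text \<open>A ray enters the subtree below \<open>u\<close> only through \<open>u\<close>, and it
  can meet \<open>u\<close> only at index \<open>n\<close>. So these elements fix \<open>C\<close>
  pointwise.\<close>

lemma Rist_subset_SStab:
  assumes C: "C \<subseteq> B" and u: "u \<in> level T n" and avoid: "\<And>\<xi>. \<xi> \<in> C \<Longrightarrow> \<xi> n \<noteq> u"
  shows "Rist T G u \<subseteq> SStab T G C"
proof
  fix r assume r: "r \<in> Rist T G u"
  have "act r \<xi> = \<xi>" if \<xi>: "\<xi> \<in> C" for \<xi>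
  proof
    fix k
    have \<xi>B: "\<xi> \<in> B" using \<xi> C by blast
    have "\<xi> k \<notin> subtree T u"
    proof
      assume "\<xi> k \<in> subtree T u"
      then obtain j where "u = \<xi> j"
        by (auto simp: subtree_def root_path_ray[OF \<xi>B] simp del: upt_Suc)
      moreover from this have "j = n"
        using u ray_level[OF \<xi>B, of j] by (simp add: level_def)
      ultimately show False using avoid[OF \<xi>] by blast
    qed
    then show "act r \<xi> k = \<xi> k"
      using r \<xi>B by (simp add: Rist_def act_apply ray_vertex)
  qed
  then have "act r ` C = C" by force
  then show "r \<in> SStab T G C"
    using r by (simp add: SStab_def Rist_def)
qed

lemma Rist_conj:
  assumes g: "g \<in> G" and u: "u \<in> verts T" and r: "r \<in> Rist T G u"
  shows "g \<otimes>\<^bsub>\<Gamma>\<^esub> r \<otimes>\<^bsub>\<Gamma>\<^esub> inv\<^bsub>\<Gamma>\<^esub> g \<in> Rist T G (g u)"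
proof -
  have rG: "r \<in> G" using r by (simp add: Rist_def)
  have "(g \<otimes>\<^bsub>\<Gamma>\<^esub> r \<otimes>\<^bsub>\<Gamma>\<^esub> inv\<^bsub>\<Gamma>\<^esub> g) w = w" if w: "w \<in> verts T" "w \<notin> subtree T (g u)" for w
  proof -
    let ?w = "(inv\<^bsub>\<Gamma>\<^esub> g) w"
    have w': "?w \<in> verts T" using g w by (simp add: G_verts inv_G)
    have "?w \<notin> subtree T u"
      using subtree_image[OF g u w'] w g by (simp add: inv_apply)
    then have "r ?w = ?w" using r w' by (simp add: Rist_def)
    then show ?thesis
      using g rG w w' by (simp add: mult_apply mult_G inv_G inv_apply)
  qed
  then show ?thesis
    using g rG by (simp add: Rist_def mult_G inv_G)
qed

text \<open>Conjugation by \<open>g\<close> sends the rigid stabilizer of \<open>u\<close> into that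
  of \<open>g u\<close>, hence into \<open>K\<close>; conjugating back stays in
  \<open>K\<close>.\<close>

lemma Rist_subset_conj:
  assumes K: "subgroup K \<Gamma>" and g: "g \<in> K" and u: "u \<in> verts T" and R: "Rist T G (g u) \<subseteq> K"
  shows "Rist T G u \<subseteq> K"
proof
  fix r assume r: "r \<in> Rist T G u"
  have gG: "g \<in> G" and rG: "r \<in> G"
    using subgroup_subset_G[OF K] g r by (auto simp: Rist_def)
  let ?s = "g \<otimes>\<^bsub>\<Gamma>\<^esub> r \<otimes>\<^bsub>\<Gamma>\<^esub> inv\<^bsub>\<Gamma>\<^esub> g"
  have "?s \<in> K" using Rist_conj[OF gG u r] R by blast
  then have "inv\<^bsub>\<Gamma>\<^esub> g \<otimes>\<^bsub>\<Gamma>\<^esub> ?s \<otimes>\<^bsub>\<Gamma>\<^esub> g \<in> K"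
    by (rule subgroup.m_closed[OF K subgroup.m_closed[OF K subgroup.m_inv_closed[OF K g]] g])
  moreover have "inv\<^bsub>\<Gamma>\<^esub> g \<otimes>\<^bsub>\<Gamma>\<^esub> ?s \<otimes>\<^bsub>\<Gamma>\<^esub> g = r"
  proof -
    have x: "r \<otimes>\<^bsub>\<Gamma>\<^esub> inv\<^bsub>\<Gamma>\<^esub> g \<in> G" using gG rG by (simp add: mult_G inv_G)
    have s: "?s = g \<otimes>\<^bsub>\<Gamma>\<^esub> (r \<otimes>\<^bsub>\<Gamma>\<^esub> inv\<^bsub>\<Gamma>\<^esub> g)"
      using gG rG by (simp add: m_assoc inv_G)
    have "inv\<^bsub>\<Gamma>\<^esub> g \<otimes>\<^bsub>\<Gamma>\<^esub> ?s = inv\<^bsub>\<Gamma>\<^esub> g \<otimes>\<^bsub>\<Gamma>\<^esub> g \<otimes>\<^bsub>\<Gamma>\<^esub> (r \<otimes>\<^bsub>\<Gamma>\<^esub> inv\<^bsub>\<Gamma>\<^esub> g)"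
      unfolding s using gG x by (intro m_assoc[symmetric]) (simp_all add: inv_G)
    also have "\<dots> = r \<otimes>\<^bsub>\<Gamma>\<^esub> inv\<^bsub>\<Gamma>\<^esub> g"
      using gG x by simp
    finally show ?thesis
      using gG rG by (simp add: m_assoc inv_G)
  qed
  ultimately show "r \<in> K" by simp
qed

text \<open>Each coset of \<open>R\<close> lies in a single coset of \<open>K\<close>, so the cosets
  of \<open>R\<close> map onto those of \<open>K\<close>.\<close>

lemma finite_index_mono:
  assumes "R \<subseteq> K" "subgroup K \<Gamma>" "subgroup R \<Gamma>" "finite_index T G R"
  shows "finite_index T G K"
proof -
  \<comment> \<open>The map of cosets is written without choosing representatives: a set goes to the
    union of the \<open>K\<close>-cosets of its elements.\<close>
  have "(\<Union>x\<in>R #>\<^bsub>\<Gamma>\<^esub> a. K #>\<^bsub>\<Gamma>\<^esub> x) = K #>\<^bsub>\<Gamma>\<^esub> a" if a: "a \<in> G" for a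
  proof -
    have "K #>\<^bsub>\<Gamma>\<^esub> x = K #>\<^bsub>\<Gamma>\<^esub> a" if "x \<in> R #>\<^bsub>\<Gamma>\<^esub> a" for x
    proof -
      have "x \<in> K #>\<^bsub>\<Gamma>\<^esub> a" using that assms(1) by (auto simp: r_coset_def)
      then show ?thesis using repr_independence[of x K a] a assms(2) by simp
    qed
    moreover have "a \<in> R #>\<^bsub>\<Gamma>\<^esub> a" using rcos_self[of a R] a assms(3) by simp
    ultimately show ?thesis by blast
  qed
  then have "rcosets\<^bsub>\<Gamma>\<^esub> K = (\<Union>a\<in>G. {\<Union>x\<in>R #>\<^bsub>\<Gamma>\<^esub> a. K #>\<^bsub>\<Gamma>\<^esub> x})"
    by (simp add: RCOSETS_def)
  also have "\<dots> = (\<lambda>X. \<Union>x\<in>X. K #>\<^bsub>\<Gamma>\<^esub> x) ` (rcosets\<^bsub>\<Gamma>\<^esub> R)"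
    by (simp add: RCOSETS_def image_UN)
  finally have "rcosets\<^bsub>\<Gamma>\<^esub> K \<subseteq> (\<lambda>X. \<Union>x\<in>X. K #>\<^bsub>\<Gamma>\<^esub> x) ` (rcosets\<^bsub>\<Gamma>\<^esub> R)"
    by simp
  then show ?thesis
    using assms(4) unfolding finite_index_def by (rule finite_surj[rotated])
qed

end

locale branch_group = tree_group +
  assumes level_transitive: "\<And>n u v. u \<in> level T n \<Longrightarrow> v \<in> level T n \<Longrightarrow> \<exists>g\<in>G. g u = v"
    and finite_index_Rist_level: "\<And>n. finite_index T G (Rist_level T G n)"
begin

text \<open>Keeping \<open>K\<close> general lets the result serve twice: weak maximality applies it
  to a larger \<open>K\<close>, injectivity to \<open>SStab T G C\<close> itself. In both cases
  \<open>K\<close> receives all generators of \<open>Rist_level T G n\<close>.\<close>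

lemma finite_index_overgroup:
  assumes C: "C \<subseteq> B" and K: "subgroup K \<Gamma>" and le: "SStab T G C \<subseteq> K"
    and trans: "prefix_transitive K C"
    and \<xi>: "\<xi> \<in> C" and R: "Rist T G (\<xi> n) \<subseteq> K"
  shows "finite_index T G K"
proof (rule finite_index_mono[OF _ K _ finite_index_Rist_level])
  have "Rist T G u \<subseteq> K" if u: "u \<in> level T n" for u
  proof (cases "\<exists>\<eta>\<in>C. \<eta> n = u")
    case True
    then obtain \<eta> k where "\<eta> \<in> C" "\<eta> n = u" "k \<in> K" "k (\<eta> n) = \<xi> n"
      using trans \<xi> unfolding prefix_transitive_def by blast
    then show ?thesis
      using Rist_subset_conj[OF K, of k u] R C ray_vertex by auto
  next
    case False
    then show ?thesis using Rist_subset_SStab[OF C u] le by blast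
  qed
  then show "Rist_level T G n \<subseteq> K"
    unfolding Rist_level_def using generate_subgroup_incl[OF _ K] by blast
  show "subgroup (Rist_level T G n) \<Gamma>"
    unfolding Rist_level_def by (rule generate_is_subgroup) (auto simp: Rist_def)
qed


section \<open>Generalized parabolic subgroups\<close>

text \<open>A finite Baire argument: the elements of \<open>A\<close> are treated one after another,
  and the cylinder of \<open>\<zeta>\<close> at level \<open>m\<close> is shrunk until its image
  under each of them misses \<open>C\<close>.\<close>

lemma exists_avoiding_ray:
  assumes C: "C \<subseteq> B" "closedin (boundary_topology T) C"
    and nowhere_dense: "\<And>\<xi> n. \<xi> \<in> C \<Longrightarrow> \<exists>\<theta>\<in>B - C. \<theta> n = \<xi> n"
    and A: "finite A" "A \<subseteq> G" and \<xi>: "\<xi> \<in> B"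
  shows "\<exists>\<zeta>\<in>B. \<exists>m. \<forall>a\<in>A. \<forall>\<eta>\<in>C. \<eta> m \<noteq> a (\<zeta> m)"
  using A
proof (induction A rule: finite_induct)
  case empty
  then show ?case using \<xi> by blast
next
  case (insert a A)
  then obtain \<zeta> m where \<zeta>: "\<zeta> \<in> B" and avoid: "\<And>b \<eta>. b \<in> A \<Longrightarrow> \<eta> \<in> C \<Longrightarrow> \<eta> m \<noteq> b (\<zeta> m)"
    by auto
  have aG: "a \<in> G" using insert by simp
  show ?case
  proof (cases "\<exists>\<eta>\<in>C. \<eta> m = a (\<zeta> m)")
    case False
    then show ?thesis
      using \<zeta> avoid by (intro bexI[of _ \<zeta>] exI[of _ m]) auto
  next
    case True
    \<comment> \<open>The cylinder at \<open>a (\<zeta> m)\<close> meets \<open>C\<close>, so it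
      also contains a ray outside \<open>C\<close>; as \<open>C\<close> is closed, a whole smaller
      cylinder around that ray misses \<open>C\<close>.\<close>
    then obtain \<theta> where \<theta>: "\<theta> \<in> B" "\<theta> \<notin> C" "\<theta> m = a (\<zeta> m)"
      using nowhere_dense by (metis DiffE)
    obtain k where k: "\<forall>\<eta>\<in>C. \<eta> k \<noteq> \<theta> k"
      using closed_avoids[OF C(2) \<theta>(1,2)] by blast
    \<comment> \<open>Pulling back by \<open>a\<close> stays in the old cylinder of
      \<open>\<zeta>\<close>, so what was achieved for \<open>A\<close> survives.\<close>
    define \<zeta>' where "\<zeta>' = act (inv\<^bsub>\<Gamma>\<^esub> a) \<theta>"
    have \<zeta>'B: "\<zeta>' \<in> B" using \<theta> aG by (simp add: \<zeta>'_def act_ray inv_G)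
    have a\<zeta>': "act a \<zeta>' = \<theta>" using \<theta> aG by (simp add: \<zeta>'_def act_inv)
    have \<zeta>'m: "\<zeta>' m = \<zeta> m"
      using \<theta> aG \<zeta> by (simp add: \<zeta>'_def act_apply inv_apply ray_vertex)
    \<comment> \<open>Agreement at depth \<open>max m k\<close> descends both to level
      \<open>m\<close>, where it is excluded for elements of \<open>A\<close>, and to level
      \<open>k\<close>, where it is excluded for \<open>a\<close>.\<close>
    have "\<eta> (max m k) \<noteq> b (\<zeta>' (max m k))" if b: "b \<in> insert a A" and \<eta>: "\<eta> \<in> C" for b \<eta>
    proof
      assume eq: "\<eta> (max m k) = b (\<zeta>' (max m k))"
      have bG: "b \<in> G" using b insert by auto
      have "\<eta> (max m k) = act b \<zeta>' (max m k)" using eq \<zeta>'B by (simp add: act_apply)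
      then have "\<eta> j = act b \<zeta>' j" if "j \<le> max m k" for j
        using rays_agree_below that \<eta> C(1) act_ray[OF bG \<zeta>'B] by blast
      then have "\<eta> m = b (\<zeta> m)" "\<eta> k = act b \<zeta>' k"
        using \<zeta>'B \<zeta>'m by (simp_all add: act_apply)
      then show False
        using b avoid[OF _ \<eta>] k \<eta> a\<zeta>' by auto
    qed
    then show ?thesis using \<zeta>'B by blast
  qed
qed

text \<open>If the stabilizer had finite index, finitely many translates of the nowhere dense set \<open>C\<close>
  would cover the dense orbit of a ray in \<open>C\<close>.\<close>

lemma infinite_index_SStab:
  assumes C: "closedin (boundary_topology T) C" "\<not> openin (boundary_topology T) C"
    and trans: "prefix_transitive (SStab T G C) C"
  shows "\<not> finite_index T G (SStab T G C)"
proof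
  let ?H = "SStab T G C"
  have CB: "C \<subseteq> B" using C(1) by (rule closedin_subset_boundary)
  have H: "subgroup ?H \<Gamma>" using CB by (rule subgroup_SStab)
  assume "finite_index T G ?H"
  moreover have "rcosets\<^bsub>\<Gamma>\<^esub> ?H = (\<lambda>a. ?H #>\<^bsub>\<Gamma>\<^esub> a) ` G"
    by (auto simp: RCOSETS_def)
  \<comment> \<open>\<open>A\<close> is a finite set of representatives of the right cosets of the
    stabilizer.\<close>
  ultimately obtain A where A: "A \<subseteq> G" "finite A"
      "(\<lambda>a. ?H #>\<^bsub>\<Gamma>\<^esub> a) ` G = (\<lambda>a. ?H #>\<^bsub>\<Gamma>\<^esub> a) ` A"
    using finite_subset_image[of "(\<lambda>a. ?H #>\<^bsub>\<Gamma>\<^esub> a) ` G" "\<lambda>a. ?H #>\<^bsub>\<Gamma>\<^esub> a" G]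
    unfolding finite_index_def by auto
  obtain \<xi> where \<xi>: "\<xi> \<in> C" "\<And>n. \<exists>\<theta>\<in>B - C. \<theta> n = \<xi> n"
    using not_open_witness[OF C(2) CB] by blast
  \<comment> \<open>Some \<open>h\<close> in the stabilizer carries the non-interior point
    \<open>\<xi>\<close> to \<open>\<eta>\<close> at level \<open>n\<close>. It also preserves the
    complement of \<open>C\<close>, so no point of \<open>C\<close> is interior.\<close>
  have nd: "\<exists>\<theta>\<in>B - C. \<theta> n = \<eta> n" if \<eta>: "\<eta> \<in> C" for \<eta> n
  proof -
    obtain \<theta> h where \<theta>: "\<theta> \<in> B" "\<theta> \<notin> C" "\<theta> n = \<xi> n" and h: "h \<in> ?H" "h (\<xi> n) = \<eta> n"
      using \<xi> trans \<eta> unfolding prefix_transitive_def by (metis DiffE)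
    have hG: "h \<in> G" using h by (simp add: SStab_def)
    have "act h \<theta> \<notin> C"
    proof
      assume "act h \<theta> \<in> C"
      then have "act (inv\<^bsub>\<Gamma>\<^esub> h) (act h \<theta>) \<in> C"
        using subgroup.m_inv_closed[OF H h(1)] SStab_act by blast
      then show False using \<theta> hG by (simp add: act_inv)
    qed
    then show ?thesis
      using act_ray[OF hG \<theta>(1)] \<theta> h by (intro bexI[of _ "act h \<theta>"]) (auto simp: act_apply)
  qed
  obtain \<zeta> m where \<zeta>: "\<zeta> \<in> B" "\<And>a \<eta>. a \<in> A \<Longrightarrow> \<eta> \<in> C \<Longrightarrow> \<eta> m \<noteq> a (\<zeta> m)"
    using exists_avoiding_ray[OF CB C(1) _ A(2,1), of \<xi>] nd \<xi>(1) CB by blast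
  have \<xi>B: "\<xi> \<in> B" using \<xi> CB by blast
  \<comment> \<open>Every element of \<open>A\<close> keeps \<open>\<zeta> m\<close> off the rays of
    \<open>C\<close>, while \<open>g\<close> takes it onto one. The representative \<open>a\<close>
    of the coset of \<open>g\<close> differs from \<open>g\<close> by some \<open>h\<close>
    preserving \<open>C\<close>, so it does the same as \<open>g\<close>: a contradiction.\<close>
  obtain g where g: "g \<in> G" "g (\<zeta> m) = \<xi> m"
    using level_transitive[OF ray_level[OF \<zeta>(1)] ray_level[OF \<xi>B]] by blast
  obtain a where a: "a \<in> A" "?H #>\<^bsub>\<Gamma>\<^esub> g = ?H #>\<^bsub>\<Gamma>\<^esub> a"
    using A(3) g(1) by (metis imageE imageI)
  then have aG: "a \<in> G" using A by blast
  have "a \<in> ?H #>\<^bsub>\<Gamma>\<^esub> g" using rcos_self[of a ?H] H aG a by simp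
  then obtain h where h: "h \<in> ?H" "a = h \<otimes>\<^bsub>\<Gamma>\<^esub> g" by (auto simp: r_coset_def)
  then have "a (\<zeta> m) = act h \<xi> m"
    using g \<zeta>(1) \<xi>B by (simp add: mult_apply ray_vertex act_apply SStab_def)
  then show False
    using \<zeta>(2)[OF a(1) SStab_act[OF h(1) \<xi>(1)]] by simp
qed

lemma SStab_weakly_maximal:
  assumes C: "closedin (boundary_topology T) C" "\<not> openin (boundary_topology T) C"
    and trans: "prefix_transitive (SStab T G C) C"
  shows "weakly_maximal T G (SStab T G C)"
proof -
  have CB: "C \<subseteq> B" using C(1) by (rule closedin_subset_boundary)
  have "K = SStab T G C"
    if K: "subgroup K \<Gamma>" and infinite: "\<not> finite_index T G K" and le: "SStab T G C \<subseteq> K" for K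
  proof -
    have "act g \<xi> \<in> C" if g: "g \<in> K" and \<xi>: "\<xi> \<in> C" for g \<xi>
    proof (rule ccontr)
      assume "act g \<xi> \<notin> C"
      moreover have gG: "g \<in> G" using g subgroup_subset_G[OF K] by blast
      moreover have \<xi>B: "\<xi> \<in> B" using \<xi> CB by blast
      ultimately obtain n where n: "\<forall>\<eta>\<in>C. \<eta> n \<noteq> act g \<xi> n"
        using closed_avoids[OF C(1) act_ray] by blast
      have "Rist T G (act g \<xi> n) \<subseteq> K"
        using Rist_subset_SStab[OF CB ray_level[OF act_ray[OF gG \<xi>B], of n]] n le by blast
      then have "Rist T G (\<xi> n) \<subseteq> K"
        using Rist_subset_conj[OF K g ray_vertex[OF \<xi>B]] \<xi>B by (simp add: act_apply)
      moreover have "prefix_transitive K C"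
        using trans le unfolding prefix_transitive_def by blast
      ultimately show False
        using finite_index_overgroup[OF CB K le _ \<xi>] infinite by blast
    qed
    then show ?thesis
      using subset_SStabI[OF CB K] le by blast
  qed
  then show ?thesis
    using infinite_index_SStab[OF assms] subgroup_SStab[OF CB]
    by (simp add: weakly_maximal_def Sub_iff)
qed

text \<open>\<open>F\<close> is contained in the stabilizer of its orbit closure, and prefix
  transitivity passes from \<open>F\<close> to anything larger.\<close>

lemma orbit_closure_parabolic:
  assumes F: "subgroup F \<Gamma>" and C: "C \<in> nonopen_orbit_closures T F"
  shows "closedin (boundary_topology T) C" "\<not> openin (boundary_topology T) C"
    "prefix_transitive (SStab T G C) C"
proof -
  obtain \<xi> where \<xi>: "\<xi> \<in> B" "C = boundary_topology T closure_of boundary_orbit T F \<xi>"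
    and "\<not> openin (boundary_topology T) C"
    using C unfolding nonopen_orbit_closures_def by blast
  then show "closedin (boundary_topology T) C" "\<not> openin (boundary_topology T) C"
    by simp_all
  have "F \<subseteq> SStab T G C"
    unfolding \<xi>(2) by (rule orbit_closure_invariant[OF F \<xi>(1)])
  moreover have "prefix_transitive F C"
    unfolding \<xi>(2) by (rule prefix_transitive_orbit_closure[OF F \<xi>(1)])
  ultimately show "prefix_transitive (SStab T G C) C"
    unfolding prefix_transitive_def by blast
qed

text \<open>This is half of injectivity; exchanging \<open>C\<close> and \<open>D\<close> gives the
  other inclusion.\<close>

lemma SStab_inj:
  assumes C: "closedin (boundary_topology T) C" "\<not> openin (boundary_topology T) C"
    and D: "closedin (boundary_topology T) D"
    and trans: "prefix_transitive (SStab T G C) C" and eq: "SStab T G C = SStab T G D"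
  shows "C \<subseteq> D"
proof
  fix \<xi> assume \<xi>: "\<xi> \<in> C"
  have CB: "C \<subseteq> B" and DB: "D \<subseteq> B"
    using C(1) D by (auto dest: closedin_subset_boundary)
  show "\<xi> \<in> D"
  proof (rule ccontr)
    assume "\<xi> \<notin> D"
    then obtain n where n: "\<forall>\<eta>\<in>D. \<eta> n \<noteq> \<xi> n"
      using closed_avoids[OF D, of \<xi>] \<xi> CB by blast
    \<comment> \<open>The vertex lies on a ray of \<open>C\<close> but on no ray of
      \<open>D\<close>, so its rigid stabilizer preserves \<open>D\<close>; \<open>eq\<close> turns
      this into a statement about \<open>C\<close>.\<close>
    have "Rist T G (\<xi> n) \<subseteq> SStab T G C"
      unfolding eq using \<xi> CB n by (intro Rist_subset_SStab[OF DB ray_level]) auto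
    then have "finite_index T G (SStab T G C)"
      by (rule finite_index_overgroup[OF CB subgroup_SStab[OF CB] subset_refl trans \<xi>])
    then show False
      using infinite_index_SStab[OF C trans] by blast
  qed
qed

end

theorem corollary1p6:
  fixes T :: "'v rooted_graph" and G F :: "('v \<Rightarrow> 'v) set"
  assumes "spherically_regular_tree T"
    and "branch T G"
    and "F \<in> Sub T G"
  shows "SStab T G \<in> nonopen_orbit_closures T F \<rightarrow> Sub T G
    \<and> inj_on (SStab T G) (nonopen_orbit_closures T F)
    \<and> SStab T G ` nonopen_orbit_closures T F \<subseteq> generalized_parabolics T G
    \<and> (\<forall>H\<in>generalized_parabolics T G. weakly_maximal T G H)"
proof -
  interpret branch_group T G
    using assms(1,2) unfolding spherically_regular_tree_def branch_def 
    by (intro branch_group.intro tree_group.intro branch_group_axioms.intro) auto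
  have F: "subgroup F \<Gamma>" using assms(3) by (simp add: Sub_iff)
  note par = orbit_closure_parabolic[OF F]
  have minimal: "acts_minimally T (SStab T G C) C \<longleftrightarrow> prefix_transitive (SStab T G C) C"
    if "closedin (boundary_topology T) C" for C
    using acts_minimally_iff[OF _ closedin_subset_boundary[OF that]] by (simp add: SStab_def)
  show ?thesis
  proof (intro conjI ballI)
    show "SStab T G \<in> nonopen_orbit_closures T F \<rightarrow> Sub T G"
      using par(1) subgroup_SStab closedin_subset_boundary by (auto simp: Sub_iff)
    show "inj_on (SStab T G) (nonopen_orbit_closures T F)"
      by (rule inj_onI, rule subset_antisym) (metis SStab_inj par)+
    show "SStab T G ` nonopen_orbit_closures T F \<subseteq> generalized_parabolics T G"
      using par minimal unfolding generalized_parabolics_def by blast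
    fix H assume "H \<in> generalized_parabolics T G"
    then show "weakly_maximal T G H"
      using SStab_weakly_maximal minimal unfolding generalized_parabolics_def by blast
  qed
qed

end
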